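(* Let $n$ and $m$ be coprime positive integers, and let $c$ be the number of diagonals in $G_{n,m,2}$. Then for each integer $g\ge 1$, there are exactly $gc$ diagonals in $G_{gn,gm,2}$.
   Context: For positive integers $n,m$, the graph $G_{n,m,2}$ (an augmented directed grid graph on a two-holed torus) is defined as follows. Its vertices are the $4nm$ cells $(i,j)$ of a grid with $2n$ rows $0\le i<2n$ (row $0$ on top) and $2m$ columns $0\le j<2m$ (column $0$ leftmost). The bijection $u$ ("up") on cells is $u(i,j)=(i-1,j)$ if $i\ge 1$, and $u(0,j)=(2n-1,(j+m)\bmod 2m)$. The bijection $r$ ("right") on cells is $r(i,j)=(i,j+1)$ if $j<2m-1$, and $r(i,2m-1)=((i+n)\bmod 2n,0)$. The directed edges are $(\alpha,u\alpha)$ and $(\alpha,r\alpha)$ for every cell $\alpha$. A diagonal is a set $\{\alpha,u^{-1}r\alpha,(u^{-1}r)^2\alpha,\dots\}$ for a cell $\alpha$, i.e. an orbit of the permutation $u^{-1}r$ (apply $r$ first, then $u^{-1}$) on cells. *)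

theory Defs
  imports Main
begin

record 'v aug_digraph =
  verts :: "'v set"
  edges :: "('v \<times> 'v) set"
  up :: "'v \<Rightarrow> 'v"
  right :: "'v \<Rightarrow> 'v"

text \<open>The last subscript of $G_{n,m,2}$, the number of holes of the torus, is fixed to 2.
  On pairs that are not cells the values of \<open>grid_up\<close> and \<open>grid_right\<close> are irrelevant.\<close>

definition cells :: "nat \<Rightarrow> nat \<Rightarrow> (nat \<times> nat) set" where
  "cells n m = {0..<2 * n} \<times> {0..<2 * m}"

definition grid_up :: "nat \<Rightarrow> nat \<Rightarrow> nat \<times> nat \<Rightarrow> nat \<times> nat" where
  "grid_up n m = (\<lambda>(i, j). if i \<ge> 1 then (i - 1, j) else (2 * n - 1, (j + m) mod (2 * m)))"

definition grid_right :: "nat \<Rightarrow> nat \<Rightarrow> nat \<times> nat \<Rightarrow> nat \<times> nat" where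
  "grid_right n m = (\<lambda>(i, j). if j < 2 * m - 1 then (i, j + 1) else ((i + n) mod (2 * n), 0))"

definition torus2_graph :: "nat \<Rightarrow> nat \<Rightarrow> (nat \<times> nat) aug_digraph" where
  "torus2_graph n m =
    \<lparr>verts = cells n m,
     edges = (\<Union>\<alpha>\<in>cells n m. {(\<alpha>, grid_up n m \<alpha>), (\<alpha>, grid_right n m \<alpha>)}),
     up = grid_up n m,
     right = grid_right n m\<rparr>"

text \<open>The inverse of \<open>up\<close> is taken on the vertex set, where \<open>up\<close> is a permutation;
  it need not be injective on the whole type.\<close>

definition diag_step :: "'v aug_digraph \<Rightarrow> 'v \<Rightarrow> 'v" where
  "diag_step G = inv_into (verts G) (up G) \<circ> right G"

definition diagonal :: "'v aug_digraph \<Rightarrow> 'v \<Rightarrow> 'v set" where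
  "diagonal G \<alpha> = {(diag_step G ^^ k) \<alpha> | k. True}"

definition diagonals :: "'v aug_digraph \<Rightarrow> 'v set set" where
  "diagonals G = diagonal G ` verts G"

lemma shift_inj:
  assumes "(a + k) mod (2 * k) = (b + k) mod (2 * k)" and "a < 2 * k" and "b < 2 * (k::nat)"
  shows "a = b"
proof -
  have "(x + k) mod (2 * k) = (if x < k then x + k else x - k)" if "x < 2 * k" for x
    using that by (simp add: mod_if)
  then show ?thesis
    using assms by (auto split: if_splits)
qed

lemma bij_betw_grid_up: "bij_betw (grid_up n m) (cells n m) (cells n m)"
proof -
  have "inj_on (grid_up n m) (cells n m)"
    by (rule inj_onI) (auto simp: cells_def grid_up_def dest: shift_inj split: if_splits)
  moreover have "grid_up n m ` cells n m \<subseteq> cells n m"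
    by (auto simp: cells_def grid_up_def split: if_splits)
  ultimately show ?thesis
    by (simp add: bij_betw_def endo_inj_surj cells_def)
qed

lemma bij_betw_grid_right: "bij_betw (grid_right n m) (cells n m) (cells n m)"
proof -
  have "inj_on (grid_right n m) (cells n m)"
    by (rule inj_onI) (auto simp: cells_def grid_right_def dest: shift_inj split: if_splits)
  moreover have "grid_right n m ` cells n m \<subseteq> cells n m"
    by (auto simp: cells_def grid_right_def split: if_splits)
  ultimately show ?thesis
    by (simp add: bij_betw_def endo_inj_surj cells_def)
qed

lemma finite_diagonals: "finite (diagonals (torus2_graph n m))"
  by (simp add: diagonals_def torus2_graph_def cells_def)

end

theory Submission
  imports Defs
begin

text \<open>Cut every cell of $G_{n,m,2}$ into $g \times g$ small cells; this is $G_{gn,gm,2}$, because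
  both gluing shifts are multiples of $g$. A diagonal step raises both small coordinates by one
  modulo $g$, so every small diagonal keeps returning to the top rows of large cells, exactly once
  every $g$ steps. Started in the top row of a large cell \<open>C\<close> at column offset \<open>d\<close>, it runs through
  \<open>C\<close> and its right neighbour and returns after $g$ steps at the same offset \<open>d\<close> in the diagonal
  successor of \<open>C\<close>. Thus the small diagonals correspond to the pairs of a large diagonal and an
  offset $d < g$.\<close>

section \<open>Counting orbits through a first return map\<close>

text \<open>The set in \<open>diagonal\<close>, freed from the graph. On a finite set permuted by
  \<open>f\<close>, nonnegative powers already give the whole orbit, as some positive power fixes
  each point.\<close>

definition forward_orbit :: "('a \<Rightarrow> 'a) \<Rightarrow> 'a \<Rightarrow> 'a set" where
  "forward_orbit f x = {(f ^^ k) x | k. True}"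

lemma funpow_in_bij_betw:
  assumes "bij_betw f A A" and "x \<in> A"
  shows "(f ^^ k) x \<in> A"
  using bij_betw_funpow[OF assms(1)] assms(2) by (rule bij_betw_apply)

text \<open>Pigeonhole: two iterates in the finite set \<open>A\<close> coincide, and injectivity of
  \<open>f ^^ k\<close> on \<open>A\<close> cancels the outer \<open>f ^^ k\<close>.\<close>

lemma funpow_returns:
  assumes "bij_betw f A A" and "finite A" and "x \<in> A"
  obtains p where "p > 0" and "(f ^^ p) x = x"
proof -
  have "range (\<lambda>k. (f ^^ k) x) \<subseteq> A"
    using funpow_in_bij_betw[OF assms(1,3)] by auto
  then have "\<not> inj (\<lambda>k. (f ^^ k) x)"
    using assms(2) finite_imageD finite_subset infinite_UNIV_nat by blast
  then obtain k l where "k < l" and eq: "(f ^^ k) x = (f ^^ l) x"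
    unfolding inj_def by (metis linorder_neqE_nat)
  then have "(f ^^ k) ((f ^^ (l - k)) x) = (f ^^ k) x"
    by (simp flip: comp_apply[of "f ^^ k" "f ^^ (l - k)"] funpow_add)
  then have "(f ^^ (l - k)) x = x"
    using bij_betw_funpow[OF assms(1)] funpow_in_bij_betw[OF assms(1,3)] assms(3)
    by (auto simp: bij_betw_def dest: inj_onD)
  with \<open>k < l\<close> that[of "l - k"] show thesis by simp
qed

lemma forward_orbit_eq_iff:
  assumes "bij_betw f A A" and "finite A" and "x \<in> A"
  shows "forward_orbit f x = forward_orbit f y \<longleftrightarrow> (\<exists>k. y = (f ^^ k) x)"
proof
  assume "forward_orbit f x = forward_orbit f y"
  moreover have "y \<in> forward_orbit f y"
    by (auto simp: forward_orbit_def intro: exI[of _ 0])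
  ultimately show "\<exists>k. y = (f ^^ k) x" by (auto simp: forward_orbit_def)
next
  assume "\<exists>k. y = (f ^^ k) x"
  then obtain k where y: "y = (f ^^ k) x" by blast
  obtain p where "p > 0" and p: "(f ^^ p) x = x"
    using funpow_returns[OF assms] .
  have "((f ^^ p) ^^ k) x = x"
    by (induction k) (simp_all add: p)
  \<comment> \<open>As \<open>y\<close> lies \<open>k\<close> steps past \<open>x\<close>, another
    \<open>p * k - k\<close> steps complete \<open>k\<close> periods; \<open>p > 0\<close> makes
    this truncated subtraction exact.\<close>
  then have "(f ^^ (p * k - k)) y = x"
    using \<open>p > 0\<close> unfolding y
    by (simp add: funpow_mult flip: comp_apply[of "f ^^ _" "f ^^ _"] funpow_add)
  then have "(f ^^ j) x = (f ^^ (j + (p * k - k))) y" and "(f ^^ j) y = (f ^^ (j + k)) x" for j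
    by (simp_all add: funpow_add y)
  then show "forward_orbit f x = forward_orbit f y"
    unfolding forward_orbit_def by blast
qed

text \<open>Both images are copies of the quotient of \<open>X\<close> by the common kernel.\<close>

lemma card_image_eq_if_same_kernel:
  assumes "\<And>x y. x \<in> X \<Longrightarrow> y \<in> X \<Longrightarrow> \<phi> x = \<phi> y \<longleftrightarrow> \<psi> x = \<psi> y"
  shows "card (\<phi> ` X) = card (\<psi> ` X)"
proof (rule bij_betw_same_card)
  have inv: "\<psi> (inv_into X \<phi> (\<phi> x)) = \<psi> x" if "x \<in> X" for x
    using that assms by (metis f_inv_into_f image_eqI inv_into_into)
  show "bij_betw (\<lambda>y. \<psi> (inv_into X \<phi> y)) (\<phi> ` X) (\<psi> ` X)"
    by (rule bij_betwI') (auto simp: inv assms)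
qed

text \<open>The points \<open>P a d\<close> form a section of \<open>S\<close> that every
  \<open>F\<close>-orbit meets, and passages between its points take only multiples of
  \<open>g\<close> steps. So \<open>F ^^ g\<close>, which acts there as \<open>f\<close> on
  \<open>a\<close> and fixes \<open>d\<close>, already decides which section points share an
  \<open>F\<close>-orbit.\<close>

lemma card_forward_orbits_section:
  assumes F: "bij_betw F S S" "finite S" and f: "bij_betw f A A" "finite A"
    and P_in: "\<And>a d. a \<in> A \<Longrightarrow> d \<in> D \<Longrightarrow> P a d \<in> S"
    and P_inj: "\<And>a d b e. a \<in> A \<Longrightarrow> d \<in> D \<Longrightarrow> b \<in> A \<Longrightarrow> e \<in> D \<Longrightarrow> P a d = P b e \<Longrightarrow> a = b \<and> d = e"
    and return: "\<And>a d. a \<in> A \<Longrightarrow> d \<in> D \<Longrightarrow> (F ^^ g) (P a d) = P (f a) d"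
    and hits: "\<And>s. s \<in> S \<Longrightarrow> \<exists>k. \<exists>a\<in>A. \<exists>d\<in>D. (F ^^ k) s = P a d"
    and period: "\<And>a d b e k. a \<in> A \<Longrightarrow> d \<in> D \<Longrightarrow> b \<in> A \<Longrightarrow> e \<in> D
      \<Longrightarrow> (F ^^ k) (P a d) = P b e \<Longrightarrow> g dvd k"
  shows "card (forward_orbit F ` S) = card D * card (forward_orbit f ` A)"
proof -
  have returns: "(F ^^ (g * q)) (P a d) = P ((f ^^ q) a) d" if "a \<in> A" "d \<in> D" for a d q
    using that by (induction q) (simp_all add: funpow_add return funpow_in_bij_betw[OF f(1)])
  \<comment> \<open>Two labellings of the pairs \<open>(a, d)\<close>: the \<open>F\<close>-orbit
    through the section point, and the \<open>f\<close>-orbit together with the offset. Equal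
    kernels give equally many labels.\<close>
  let ?\<phi> = "\<lambda>(a, d). forward_orbit F (P a d)" and ?\<psi> = "\<lambda>(a, d). (forward_orbit f a, d)"
  have "forward_orbit F (P a d) = forward_orbit F (P b e) \<longleftrightarrow>
      forward_orbit f a = forward_orbit f b \<and> d = e"
    if ad: "a \<in> A" "d \<in> D" and be: "b \<in> A" "e \<in> D" for a d b e
  proof -
    have "(\<exists>k. P b e = (F ^^ k) (P a d)) \<longleftrightarrow> (\<exists>q. b = (f ^^ q) a) \<and> d = e"
    proof
      assume "\<exists>k. P b e = (F ^^ k) (P a d)"
      then obtain k where k: "P b e = (F ^^ k) (P a d)" by blast
      with period[OF ad be] obtain q where "k = g * q" by auto
      with k returns[OF ad] have "P b e = P ((f ^^ q) a) d" by simp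
      with P_inj be ad funpow_in_bij_betw[OF f(1)] show "(\<exists>q. b = (f ^^ q) a) \<and> d = e"
        by blast
    next
      assume "(\<exists>q. b = (f ^^ q) a) \<and> d = e"
      with returns[OF ad] show "\<exists>k. P b e = (F ^^ k) (P a d)" by metis
    qed
    then show ?thesis
      by (simp only: forward_orbit_eq_iff[OF F P_in[OF ad]] forward_orbit_eq_iff[OF f ad(1)])
  qed
  then have "card (?\<phi> ` (A \<times> D)) = card (?\<psi> ` (A \<times> D))"
    by (intro card_image_eq_if_same_kernel) (simp add: mem_Times_iff split_beta)
  moreover have "?\<phi> ` (A \<times> D) = forward_orbit F ` S"
  proof
    show "?\<phi> ` (A \<times> D) \<subseteq> forward_orbit F ` S" using P_in by auto
    show "forward_orbit F ` S \<subseteq> ?\<phi> ` (A \<times> D)"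
    proof
      fix Y assume "Y \<in> forward_orbit F ` S"
      then obtain s where s: "s \<in> S" "Y = forward_orbit F s" by blast
      obtain k a d where "a \<in> A" "d \<in> D" "(F ^^ k) s = P a d"
        using hits[OF s(1)] by blast
      moreover from this have "Y = forward_orbit F (P a d)"
        using forward_orbit_eq_iff[OF F s(1)] s(2) by metis
      ultimately show "Y \<in> ?\<phi> ` (A \<times> D)" by (auto intro!: rev_image_eqI[of "(a, d)"])
    qed
  qed
  moreover have "?\<psi> ` (A \<times> D) = (forward_orbit f ` A) \<times> D" by auto
  ultimately show ?thesis by (simp add: card_cartesian_product)
qed

section \<open>Subdividing cells\<close>

text \<open>Closed form of the inverse of \<open>grid_up\<close> on cells, which eliminates
  \<open>inv_into\<close>. The wrap uses the same shift \<open>m\<close> as \<open>grid_up\<close>,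
  since shifting by \<open>m\<close> modulo \<open>2 * m\<close> is an involution.\<close>

definition grid_down :: "nat \<Rightarrow> nat \<Rightarrow> nat \<times> nat \<Rightarrow> nat \<times> nat" where
  "grid_down n m = (\<lambda>(i, j). if i < 2 * n - 1 then (i + 1, j) else (0, (j + m) mod (2 * m)))"

lemma grid_down_in_cells: "x \<in> cells n m \<Longrightarrow> grid_down n m x \<in> cells n m"
  by (auto simp: cells_def grid_down_def)

lemma grid_right_in_cells: "x \<in> cells n m \<Longrightarrow> grid_right n m x \<in> cells n m"
  using bij_betw_apply[OF bij_betw_grid_right] .

lemma grid_up_down: "x \<in> cells n m \<Longrightarrow> grid_up n m (grid_down n m x) = x"
  by (auto simp: cells_def grid_down_def grid_up_def mod_if split: if_splits)

lemma diag_step_torus2: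
  assumes "x \<in> cells n m"
  shows "diag_step (torus2_graph n m) x = grid_down n m (grid_right n m x)"
proof -
  have "inv_into (cells n m) (grid_up n m) y = grid_down n m y" if "y \<in> cells n m" for y
    using that bij_betw_grid_up[of n m]
    by (intro inv_into_f_eq) (auto simp: bij_betw_def grid_down_in_cells grid_up_down)
  then show ?thesis
    using grid_right_in_cells[OF assms] by (simp add: diag_step_def torus2_graph_def)
qed

lemma verts_torus2: "verts (torus2_graph n m) = cells n m"
  by (simp add: torus2_graph_def)

lemma bij_betw_diag_step:
  "bij_betw (diag_step (torus2_graph n m)) (cells n m) (cells n m)"
  unfolding diag_step_def torus2_graph_def
  using bij_betw_trans[OF bij_betw_grid_right bij_betw_inv_into[OF bij_betw_grid_up]] by simp

text \<open>The offsets \<open>a\<close> and \<open>b\<close> count small rows and columns from the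
  top left corner of the large cell \<open>C\<close>, and are meant to be below
  \<open>g\<close>.\<close>

definition subcell :: "nat \<Rightarrow> nat \<times> nat \<Rightarrow> nat \<Rightarrow> nat \<Rightarrow> nat \<times> nat" where
  "subcell g C a b = (g * fst C + a, g * snd C + b)"

lemma subdivision_less_iff:
  fixes g :: nat
  assumes "b < g"
  shows "g * J + b < g * M \<longleftrightarrow> J < M"
proof
  show "g * J + b < g * M \<Longrightarrow> J < M"
    by (metis add_lessD1 mult_less_cancel1)
  assume "J < M"
  then have "g * Suc J \<le> g * M" by (intro mult_le_mono2) simp
  with assms show "g * J + b < g * M" by simp
qed

lemma subdivision_mod:
  fixes g :: nat
  assumes "b < g"
  shows "(g * J + b) mod (g * M) = g * (J mod M) + b"
  using assms by (simp add: mod_mult2_eq)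

text \<open>A small line is the last of the grid only if it is the last of its block and the block
  is the last one. The form fits the wrap tests in \<open>grid_right\<close> and
  \<open>grid_down\<close>.\<close>

lemma Suc_subdivision_less_iff:
  fixes g :: nat
  assumes "b < g" and "J < M"
  shows "g * J + b < g * M - 1 \<longleftrightarrow> Suc b < g \<or> J < M - 1"
proof (cases "Suc b < g")
  case True
  with subdivision_less_iff[OF True, of J M] assms show ?thesis by simp
next
  case False
  then have "Suc (g * J + b) = g * Suc J + 0" using assms by simp
  then have "g * J + b < g * M - 1 \<longleftrightarrow> g * Suc J + 0 < g * M" by linarith
  with subdivision_less_iff[of 0 g "Suc J" M] assms False show ?thesis by auto
qed

lemma subcell_in_cells_iff:
  assumes "a < g" and "b < g"
  shows "subcell g C a b \<in> cells (g * n) (g * m) \<longleftrightarrow> C \<in> cells n m"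
  using subdivision_less_iff[OF assms(1), of "fst C" "2 * n"]
    subdivision_less_iff[OF assms(2), of "snd C" "2 * m"]
  by (cases C) (simp add: subcell_def cells_def mult.left_commute)

lemma subcell_inject:
  assumes "a < g" "b < g" "a' < g" "b' < g" and "subcell g C a b = subcell g C' a' b'"
  shows "C = C' \<and> a = a' \<and> b = b'"
proof -
  have *: "x = y \<and> s = t" if "g * x + s = g * y + t" "s < g" "t < g" for x y s t :: nat
    using arg_cong[OF that(1), of "\<lambda>z. z div g"] arg_cong[OF that(1), of "\<lambda>z. z mod g"] that(2,3)
    by simp
  show ?thesis
    using assms *[of "fst C" a "fst C'" a'] *[of "snd C" b "snd C'" b']
    by (simp add: subcell_def prod_eq_iff)
qed

lemma subcell_cases:
  assumes "x \<in> cells (g * n) (g * m)" and "g > 0"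
  obtains C a b where "C \<in> cells n m" "a < g" "b < g" "x = subcell g C a b"
proof -
  have x: "x = subcell g (fst x div g, snd x div g) (fst x mod g) (snd x mod g)"
    by (simp add: subcell_def)
  with assms subcell_in_cells_iff[of "fst x mod g" g "snd x mod g"] that show thesis
    by (metis mod_less_divisor)
qed

lemma grid_right_subcell:
  assumes "C \<in> cells n m" "a < g" "b < g"
  shows "grid_right (g * n) (g * m) (subcell g C a b) =
    (if Suc b < g then subcell g C a (Suc b) else subcell g (grid_right n m C) a 0)"
proof -
  obtain I J where C: "C = (I, J)" by (cases C)
  with assms have "I < 2 * n" "J < 2 * m" by (simp_all add: cells_def)
  note lt = Suc_subdivision_less_iff[OF assms(3) this(2)]
  \<comment> \<open>The gluing shift \<open>g * n\<close> is a multiple of \<open>g\<close>, so a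
    wrap shifts the large row by \<open>n\<close> and keeps the offset \<open>a\<close>.\<close>
  have md: "(g * I + a + g * n) mod (2 * (g * n)) = g * ((I + n) mod (2 * n)) + a"
    using subdivision_mod[OF assms(2), of "I + n" "2 * n"] by (simp add: algebra_simps)
  show ?thesis
  proof (cases "Suc b < g")
    case True
    with lt show ?thesis by (simp add: C subcell_def grid_right_def mult.left_commute)
  next
    case False
    then have "Suc b = g" using assms by simp
    then have "Suc (g * J + b) = g * Suc J" by simp
    with False lt show ?thesis
      by (simp add: C subcell_def grid_right_def mult.left_commute md[unfolded mult.left_commute[of 2]])
  qed
qed

lemma grid_down_subcell:
  assumes "C \<in> cells n m" "a < g" "b < g"
  shows "grid_down (g * n) (g * m) (subcell g C a b) =
    (if Suc a < g then subcell g C (Suc a) b else subcell g (grid_down n m C) 0 b)"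
proof -
  obtain I J where C: "C = (I, J)" by (cases C)
  with assms have "I < 2 * n" "J < 2 * m" by (simp_all add: cells_def)
  note lt = Suc_subdivision_less_iff[OF assms(2) this(1)]
  have md: "(g * J + b + g * m) mod (2 * (g * m)) = g * ((J + m) mod (2 * m)) + b"
    using subdivision_mod[OF assms(3), of "J + m" "2 * m"] by (simp add: algebra_simps)
  show ?thesis
  proof (cases "Suc a < g")
    case True
    with lt show ?thesis by (simp add: C subcell_def grid_down_def mult.left_commute)
  next
    case False
    then have "Suc a = g" using assms by simp
    then have "Suc (g * I + a) = g * Suc I" by simp
    with False lt show ?thesis
      by (simp add: C subcell_def grid_down_def mult.left_commute md[unfolded mult.left_commute[of 2]])
  qed
qed

section \<open>Return map and return times of the small diagonals\<close>

context
  fixes n m g :: nat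
  assumes g_pos: "g > 0"
begin

private abbreviation "F \<equiv> diag_step (torus2_graph (g * n) (g * m))"
private abbreviation "f \<equiv> diag_step (torus2_graph n m)"

lemma diag_step_subcell:
  assumes "C \<in> cells n m" "a < g" "b < g"
  shows "F (subcell g C a b) =
    (if Suc b < g
     then if Suc a < g then subcell g C (Suc a) (Suc b)
          else subcell g (grid_down n m C) 0 (Suc b)
     else if Suc a < g then subcell g (grid_right n m C) (Suc a) 0 else subcell g (f C) 0 0)"
  using assms
  by (simp add: diag_step_torus2 subcell_in_cells_iff grid_right_subcell grid_down_subcell
      grid_right_in_cells)

lemma diag_step_funpow_inside:
  assumes "C \<in> cells n m" "a + k < g" "b + k < g"
  shows "(F ^^ k) (subcell g C a b) = subcell g C (a + k) (b + k)"
  using assms(2,3) by (induction k) (simp_all add: diag_step_subcell assms(1))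

lemma diag_step_funpow_return:
  assumes C: "C \<in> cells n m" and "d < g"
  shows "(F ^^ g) (subcell g C 0 d) = subcell g (f C) 0 d"
proof -
  \<comment> \<open>After \<open>k\<close> steps the column offset has grown from \<open>d\<close>
    to \<open>g - 1\<close>, so the next step crosses the right edge of \<open>C\<close>. For
    \<open>d = 0\<close> the row offset is then \<open>g - 1\<close> too, and that step passes
    through the corner straight into \<open>f C\<close>.\<close>
  define k where "k = g - Suc d"
  have "(F ^^ k) (subcell g C 0 d) = subcell g C k (g - 1)"
    using diag_step_funpow_inside[OF C, of 0 k d] assms(2) by (simp add: k_def)
  then have step: "(F ^^ Suc k) (subcell g C 0 d) =
      (if d = 0 then subcell g (f C) 0 0 else subcell g (grid_right n m C) (Suc k) 0)"
    using assms by (auto simp: diag_step_subcell k_def)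
  show ?thesis
  proof (cases d)
    case 0
    then have "Suc k = g" using assms by (simp add: k_def)
    with step 0 show ?thesis by simp
  next
    case (Suc e)
    \<comment> \<open>There remain \<open>d = Suc e\<close> steps: \<open>e\<close> inside the right
      neighbour, down to its last small row, and one across its bottom edge, arriving at column
      offset \<open>d\<close>.\<close>
    have g: "g = Suc e + Suc k" using assms Suc by (simp add: k_def)
    have step': "(F ^^ Suc k) (subcell g C 0 d) = subcell g (grid_right n m C) (Suc k) 0"
      using step Suc by (simp del: funpow.simps)
    have "(F ^^ g) (subcell g C 0 d) = (F ^^ Suc e) ((F ^^ Suc k) (subcell g C 0 d))"
      by (subst (1) g) (simp only: funpow_add comp_apply)
    also have "\<dots> = F ((F ^^ e) (subcell g (grid_right n m C) (Suc k) 0))"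
      unfolding step' by simp
    also have "\<dots> = F (subcell g (grid_right n m C) (Suc k + e) e)"
      using diag_step_funpow_inside[OF grid_right_in_cells[OF C], of "Suc k" e 0] g by simp
    also have "\<dots> = subcell g (grid_down n m (grid_right n m C)) 0 d"
    proof -
      have "Suc (Suc k + e) = g" "Suc k + e < g" "e < g" "Suc e < g"
        using g by simp_all
      with Suc C show ?thesis
        by (simp add: diag_step_subcell grid_right_in_cells)
    qed
    finally show ?thesis using C by (simp add: diag_step_torus2)
  qed
qed

text \<open>The row residue modulo \<open>g\<close> serves as a clock: each step advances it by one,
  also across cell borders and gluings, where the offset \<open>g - 1\<close> turns into
  \<open>0\<close>.\<close>

lemma diag_step_row_mod:
  assumes "x \<in> cells (g * n) (g * m)"
  shows "fst ((F ^^ k) x) mod g = (fst x + k) mod g"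
proof (induction k)
  case (Suc k)
  have "fst (F y) mod g = Suc (fst y) mod g" if y: "y \<in> cells (g * n) (g * m)" for y
  proof -
    obtain C a b where "C \<in> cells n m" "a < g" "b < g" and y: "y = subcell g C a b"
      using subcell_cases[OF y g_pos] .
    moreover have "Suc (g * I + a) mod g = (if Suc a < g then Suc a else 0)" for I
    proof -
      have "Suc (g * I + a) mod g = (g * I + Suc a) mod g" by simp
      also have "\<dots> = Suc a mod g" by (simp only: mod_mult_self4)
      finally show ?thesis using \<open>a < g\<close> by (simp add: mod_Suc)
    qed
    ultimately show ?thesis
      by (auto simp: diag_step_subcell) (simp_all add: subcell_def)
  qed
  with Suc funpow_in_bij_betw[OF bij_betw_diag_step assms] show ?case
    by (simp, metis mod_Suc_eq)
qed simp

lemma card_diagonals_subdivision: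
  "card (diagonals (torus2_graph (g * n) (g * m))) = g * card (diagonals (torus2_graph n m))"
proof -
  have "card (forward_orbit F ` cells (g * n) (g * m)) =
      card {..<g} * card (forward_orbit f ` cells n m)"
  proof (rule card_forward_orbits_section[where P = "\<lambda>C d. subcell g C 0 d" and g = g])
    show "\<exists>k. \<exists>C\<in>cells n m. \<exists>d\<in>{..<g}. (F ^^ k) s = subcell g C 0 d"
      if s: "s \<in> cells (g * n) (g * m)" for s
    proof -
      \<comment> \<open>The time until the clock shows \<open>0\<close>; from a top row this is a
        full round of \<open>g\<close> steps, which still ends in a top row.\<close>
      define k where "k = g - fst s mod g"
      have "(fst s + k) mod g = (fst s mod g + k) mod g" by (simp add: mod_add_left_eq)
      also have "\<dots> = 0" using g_pos by (simp add: k_def)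
      finally have "fst ((F ^^ k) s) mod g = 0" using diag_step_row_mod[OF s] by simp
      moreover obtain C a b where "C \<in> cells n m" "a < g" "b < g" "(F ^^ k) s = subcell g C a b"
        using subcell_cases[OF funpow_in_bij_betw[OF bij_betw_diag_step s] g_pos] .
      ultimately show ?thesis by (auto simp: subcell_def)
    qed
    show "g dvd k" if "C \<in> cells n m" "d \<in> {..<g}"
      "(F ^^ k) (subcell g C 0 d) = subcell g C' 0 e" for C d C' e k
    proof -
      have "subcell g C 0 d \<in> cells (g * n) (g * m)"
        using that g_pos by (simp add: subcell_in_cells_iff)
      \<comment> \<open>Both ends lie in top rows, so the clock reads \<open>0\<close> at each and
        has advanced by a multiple of \<open>g\<close>.\<close>
      from diag_step_row_mod[OF this, of k] that(3) show ?thesis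
        by (simp add: subcell_def mod_eq_0_iff_dvd)
    qed
    show "C = C' \<and> d = e" if "d \<in> {..<g}" "e \<in> {..<g}" "subcell g C 0 d = subcell g C' 0 e"
      for C d C' e
      using subcell_inject[of 0 g d 0 e] that g_pos by simp
    show "finite (cells n m)" "finite (cells (g * n) (g * m))"
      by (simp_all add: cells_def)
  qed (use g_pos in \<open>simp_all add: bij_betw_diag_step subcell_in_cells_iff diag_step_funpow_return\<close>)
  then show ?thesis
    unfolding diagonals_def diagonal_def forward_orbit_def verts_torus2 by simp
qed

end

theorem proposition2:
  fixes n m c :: nat
  assumes "n > 0" and "m > 0" and "coprime n m"
    and "c = card (diagonals (torus2_graph n m))"
  shows "\<forall>g\<ge>1. card (diagonals (torus2_graph (g * n) (g * m))) = g * c"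
  using card_diagonals_subdivision assms(4) by simp

end
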